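(* In an arbitrary geometric algebra $C\ell_{p,q,r}$, $p+q+r=n\ge1$, the groups $\tilde Q^{\overline{kl}}_{p,q,r}$ and $\tilde\Gamma^{\overline{kl}}_{p,q,r}$ (defined in the context) satisfy $$\tilde Q^{\overline{01}}_{p,q,r}=\tilde\Gamma^{\overline{01}}_{p,q,r},\qquad \tilde Q^{\overline{23}}_{p,q,r}=\tilde\Gamma^{\overline{23}}_{p,q,r},\qquad \tilde Q^{\overline{12}}_{p,q,r}=\tilde\Gamma^{\overline{12}}_{p,q,r}\ \subseteq\ \tilde Q^{\overline{03}}_{p,q,r}=\tilde\Gamma^{\overline{03}}_{p,q,r}.$$
   Context: $C\ell_{p,q,r}$, $p+q+r=n\ge1$, is the Clifford (geometric) algebra over the real space $\mathbb{R}^{p,q,r}$ or the complex space $\mathbb{C}^{p+q,0,r}$ (field $\mathbb{F}=\mathbb{R}$ or $\mathbb{C}$ respectively), with identity $e$ and generators $e_1,\dots,e_n$ satisfying $e_ae_b+e_be_a=2\eta_{ab}e$, where $\eta$ is diagonal with $p$ entries $+1$, then $q$ entries $-1$, then $r$ entries $0$ (in the complex case, $p+q$ entries $+1$ and $r$ entries $0$). $C\ell^k_{p,q,r}$ is the grade-$k$ subspace, spanned by $e_{a_1}\cdots e_{a_k}$, $a_1<\dots<a_k$ (it is $\{0\}$ for $k<0$ or $k>n$). $\widehat U$ is the grade involution (multiplication by $(-1)^k$ on grade $k$), $\widetilde U$ is the reversion (multiplication by $(-1)^{k(k-1)/2}$ on grade $k$, an anti-automorphism), $\widehat{\widetilde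 U}$ is the Clifford conjugation. $\langle U\rangle_{(0)}$ and $\langle U\rangle_{(1)}$ are the even and odd parts of $U$. For $k=0,1,2,3$, $C\ell^{\overline{k}}_{p,q,r}=\{U:\ \widehat U=(-1)^kU,\ \widetilde U=(-1)^{k(k-1)/2}U\}$ (the direct sum of the subspaces of grades congruent to $k$ mod $4$), and $C\ell^{\overline{kl}}_{p,q,r}=C\ell^{\overline{k}}_{p,q,r}\oplus C\ell^{\overline{l}}_{p,q,r}$. For a subset $H\subseteq C\ell_{p,q,r}$, $H^\times$ denotes the set of invertible elements of $H$. Centralizers and twisted centralizers of grade subspaces: $Z^m_{p,q,r}=\{X\in C\ell_{p,q,r}:\ XV=VX\ \ \forall V\in C\ell^m_{p,q,r}\}$ and $\check Z^m_{p,q,r}=\{X\in C\ell_{p,q,r}:\ \widehat XV=VX\ \ \forall V\in C\ell^m_{p,q,r}\}$ (if $m>n$, then $C\ell^m_{p,q,r}=\{0\}$ and both are all of $C\ell_{p,q,r}$). Groups: $\tilde Q^{\overline{01}}_{p,q,r}=\{T\in C\ell^\times_{p,q,r}:\ \widetilde TT\in Z^{4\times}_{p,q,r},\ \widehat{\widetilde T}T\in\check Z^{1\times}_{p,q,r}\}$, $\tilde Q^{\overline{23}}_{p,q,r}=\{T\in C\ell^\times_{p,q,r}:\ \widetilde TT\in Z^{2\times}_{p,q,r},\ \widehat{\widetilde T}T\in\check Z^{3\times}_{p,q,r}\}$, $\tilde Q^{\overline{12}}_{p,q,r}=\{T\in C\ell^\times_{p,q,r}:\ \widetilde TT\in\check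 Z^{1\times}_{p,q,r},\ \widehat{\widetilde T}T\in Z^{2\times}_{p,q,r}\}$, $\tilde Q^{\overline{03}}_{p,q,r}=\{T\in C\ell^\times_{p,q,r}:\ \widetilde TT\in\check Z^{3\times}_{p,q,r},\ \widehat{\widetilde T}T\in Z^{4\times}_{p,q,r}\}$. The twisted adjoint representation $\tilde{\mathrm{ad}}$ is $\tilde{\mathrm{ad}}_T(U)=T\langle U\rangle_{(0)}T^{-1}+\widehat T\langle U\rangle_{(1)}T^{-1}$ for $T\in C\ell^\times_{p,q,r}$, $U\in C\ell_{p,q,r}$, and $\tilde\Gamma^{\overline{kl}}_{p,q,r}=\{T\in C\ell^\times_{p,q,r}:\ \tilde{\mathrm{ad}}_T(C\ell^{\overline{kl}}_{p,q,r})\subseteq C\ell^{\overline{kl}}_{p,q,r}\}$. *)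

theory Defs
  imports Complex_Main "HOL-Algebra.Module" "HOL-Algebra.AbelCoset"
begin

text \<open>
  The Clifford algebra of signature $(p,q,r)$, $n = p+q+r$, over a field is modelled in coordinates
  with respect to the basis $e_A = e_{a_1} \cdots e_{a_k}$ indexed by the subsets
  $A = \{a_1 < \dots < a_k\}$ of $\{1,\dots,n\}$: a multivector is its coefficient function, and it
  vanishes on index sets that are not subsets of $\{1,\dots,n\}$.
\<close>

type_synonym 'f mv = "nat set \<Rightarrow> 'f"

definition metric :: "nat \<Rightarrow> nat \<Rightarrow> nat \<Rightarrow> 'f::field" where
  "metric p q a = (if a \<le> p then 1 else if a \<le> p + q then -1 else 0)"

text \<open>
  $e_A e_B = \pm \bigl(\prod_{a \in A \cap B} \eta_{aa}\bigr) e_{A \triangle B}$, the sign being the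
  parity of the number of transpositions of distinct generators that sort the concatenation of
  $A$ and $B$.
\<close>

definition blade_coeff :: "nat \<Rightarrow> nat \<Rightarrow> nat set \<Rightarrow> nat set \<Rightarrow> 'f::field" where
  "blade_coeff p q A B =
     (-1) ^ card {(a, b). a \<in> A \<and> b \<in> B \<and> b < a} * (\<Prod>a\<in>A \<inter> B. metric p q a)"

definition blade :: "nat set \<Rightarrow> 'f::field mv" where
  "blade A = (\<lambda>B. if B = A then 1 else 0)"

definition Cl :: "nat \<Rightarrow> nat \<Rightarrow> nat \<Rightarrow> ('f::field, 'f mv) module" where
  "Cl p q r =
    \<lparr>carrier = {U. \<forall>A. U A \<noteq> 0 \<longrightarrow> A \<subseteq> {1..p+q+r}},
     monoid.mult = (\<lambda>U V C. \<Sum>A\<in>Pow {1..p+q+r}. \<Sum>B\<in>Pow {1..p+q+r}.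
        if sym_diff A B = C then blade_coeff p q A B * U A * V B else 0),
     one = blade {},
     zero = (\<lambda>A. 0),
     add = (\<lambda>U V A. U A + V A),
     smult = (\<lambda>c U A. c * U A)\<rparr>"

definition Cl_grade :: "nat \<Rightarrow> nat \<Rightarrow> nat \<Rightarrow> nat \<Rightarrow> 'f::field mv set" where
  "Cl_grade p q r k = {U \<in> carrier (Cl p q r). \<forall>A. U A \<noteq> 0 \<longrightarrow> card A = k}"

definition grade_inv :: "'f::field mv \<Rightarrow> 'f mv" where
  "grade_inv U = (\<lambda>A. (-1) ^ card A * U A)"

definition reversion :: "'f::field mv \<Rightarrow> 'f mv" where
  "reversion U = (\<lambda>A. (-1) ^ (card A * (card A - 1) div 2) * U A)"

definition cliff_conj :: "'f::field mv \<Rightarrow> 'f mv" where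
  "cliff_conj U = grade_inv (reversion U)"

definition even_part :: "'f::field mv \<Rightarrow> 'f mv" where
  "even_part U = (\<lambda>A. if even (card A) then U A else 0)"

definition odd_part :: "'f::field mv \<Rightarrow> 'f mv" where
  "odd_part U = (\<lambda>A. if odd (card A) then U A else 0)"

text \<open>The subspaces $C\ell^{\overline{k}}$ and $C\ell^{\overline{kl}}$, intended for
  $k, l \in \{0,1,2,3\}$.\<close>

definition Cl_type :: "nat \<Rightarrow> nat \<Rightarrow> nat \<Rightarrow> nat \<Rightarrow> 'f::field mv set" where
  "Cl_type p q r k = {U \<in> carrier (Cl p q r).
     grade_inv U = (-1) ^ k \<odot>\<^bsub>Cl p q r\<^esub> U \<and>
     reversion U = (-1) ^ (k * (k - 1) div 2) \<odot>\<^bsub>Cl p q r\<^esub> U}"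

definition Cl_type2 :: "nat \<Rightarrow> nat \<Rightarrow> nat \<Rightarrow> nat \<Rightarrow> nat \<Rightarrow> 'f::field mv set" where
  "Cl_type2 p q r k l = Cl_type p q r k <+>\<^bsub>Cl p q r\<^esub> Cl_type p q r l"

definition invertibles :: "nat \<Rightarrow> nat \<Rightarrow> nat \<Rightarrow> 'f::field mv set \<Rightarrow> 'f mv set" where
  "invertibles p q r H = H \<inter> Units (Cl p q r)"

definition centralizer :: "nat \<Rightarrow> nat \<Rightarrow> nat \<Rightarrow> nat \<Rightarrow> 'f::field mv set" where
  "centralizer p q r m = {X \<in> carrier (Cl p q r). \<forall>V \<in> Cl_grade p q r m.
     X \<otimes>\<^bsub>Cl p q r\<^esub> V = V \<otimes>\<^bsub>Cl p q r\<^esub> X}"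

definition twisted_centralizer :: "nat \<Rightarrow> nat \<Rightarrow> nat \<Rightarrow> nat \<Rightarrow> 'f::field mv set" where
  "twisted_centralizer p q r m = {X \<in> carrier (Cl p q r). \<forall>V \<in> Cl_grade p q r m.
     grade_inv X \<otimes>\<^bsub>Cl p q r\<^esub> V = V \<otimes>\<^bsub>Cl p q r\<^esub> X}"

definition Q01 :: "nat \<Rightarrow> nat \<Rightarrow> nat \<Rightarrow> 'f::field mv set" where
  "Q01 p q r = {T \<in> Units (Cl p q r).
     reversion T \<otimes>\<^bsub>Cl p q r\<^esub> T \<in> invertibles p q r (centralizer p q r 4) \<and>
     cliff_conj T \<otimes>\<^bsub>Cl p q r\<^esub> T \<in> invertibles p q r (twisted_centralizer p q r 1)}"

definition Q23 :: "nat \<Rightarrow> nat \<Rightarrow> nat \<Rightarrow> 'f::field mv set" where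
  "Q23 p q r = {T \<in> Units (Cl p q r).
     reversion T \<otimes>\<^bsub>Cl p q r\<^esub> T \<in> invertibles p q r (centralizer p q r 2) \<and>
     cliff_conj T \<otimes>\<^bsub>Cl p q r\<^esub> T \<in> invertibles p q r (twisted_centralizer p q r 3)}"

definition Q12 :: "nat \<Rightarrow> nat \<Rightarrow> nat \<Rightarrow> 'f::field mv set" where
  "Q12 p q r = {T \<in> Units (Cl p q r).
     reversion T \<otimes>\<^bsub>Cl p q r\<^esub> T \<in> invertibles p q r (twisted_centralizer p q r 1) \<and>
     cliff_conj T \<otimes>\<^bsub>Cl p q r\<^esub> T \<in> invertibles p q r (centralizer p q r 2)}"

definition Q03 :: "nat \<Rightarrow> nat \<Rightarrow> nat \<Rightarrow> 'f::field mv set" where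
  "Q03 p q r = {T \<in> Units (Cl p q r).
     reversion T \<otimes>\<^bsub>Cl p q r\<^esub> T \<in> invertibles p q r (twisted_centralizer p q r 3) \<and>
     cliff_conj T \<otimes>\<^bsub>Cl p q r\<^esub> T \<in> invertibles p q r (centralizer p q r 4)}"

definition twisted_ad :: "nat \<Rightarrow> nat \<Rightarrow> nat \<Rightarrow> 'f::field mv \<Rightarrow> 'f mv \<Rightarrow> 'f mv" where
  "twisted_ad p q r T U =
     (T \<otimes>\<^bsub>Cl p q r\<^esub> even_part U \<otimes>\<^bsub>Cl p q r\<^esub> inv\<^bsub>Cl p q r\<^esub> T) \<oplus>\<^bsub>Cl p q r\<^esub>
     (grade_inv T \<otimes>\<^bsub>Cl p q r\<^esub> odd_part U \<otimes>\<^bsub>Cl p q r\<^esub> inv\<^bsub>Cl p q r\<^esub> T)"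

definition twisted_Gamma :: "nat \<Rightarrow> nat \<Rightarrow> nat \<Rightarrow> nat \<Rightarrow> nat \<Rightarrow> 'f::field mv set" where
  "twisted_Gamma p q r k l = {T \<in> Units (Cl p q r).
     twisted_ad p q r T ` Cl_type2 p q r k l \<subseteq> Cl_type2 p q r k l}"


subsection \<open>The coordinate model is the Clifford algebra\<close>

text \<open>
  The structure is a unital associative ring, the generators satisfy the defining relations
  of the Clifford algebra, and the basis vector with index set $A$ is the ordered product of the
  generators with indices in $A$.
\<close>

lemma Cl_simps:
  "carrier (Cl p q r) = {U. \<forall>A. U A \<noteq> 0 \<longrightarrow> A \<subseteq> {1..p+q+r}}"
  "U \<otimes>\<^bsub>Cl p q r\<^esub> V = (\<lambda>C. \<Sum>A\<in>Pow {1..p+q+r}. \<Sum>B\<in>Pow {1..p+q+r}.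
     if sym_diff A B = C then blade_coeff p q A B * U A * V B else 0)"
  "\<one>\<^bsub>Cl p q r\<^esub> = blade {}"
  "\<zero>\<^bsub>Cl p q r\<^esub> = (\<lambda>A. 0)"
  "U \<oplus>\<^bsub>Cl p q r\<^esub> V = (\<lambda>A. U A + V A)"
  "c \<odot>\<^bsub>Cl p q r\<^esub> U = (\<lambda>A. c * U A)"
  by (simp_all add: Cl_def)

lemma blade_coeff_prod:
  assumes "finite N" "A \<subseteq> N" "B \<subseteq> N"
  shows "blade_coeff p q A B =
    (\<Prod>a\<in>N. \<Prod>b\<in>N. if a \<in> A \<and> b \<in> B \<and> b < a then -1 else 1) *
    (\<Prod>a\<in>N. if a \<in> A \<and> a \<in> B then metric p q a else (1::'f::field))"
proof -
  let ?S = "{(a, b). a \<in> A \<and> b \<in> B \<and> b < a}"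
  have S: "?S \<subseteq> N \<times> N" using assms by auto
  have "(\<Prod>a\<in>N. \<Prod>b\<in>N. if a \<in> A \<and> b \<in> B \<and> b < a then -1 else (1::'f))
      = (\<Prod>x\<in>N\<times>N. if x \<in> ?S then -1 else 1)"
    by (subst prod.cartesian_product) (auto intro!: prod.cong)
  also have "\<dots> = (\<Prod>x\<in>(N\<times>N) \<inter> ?S. -1)"
    using assms(1) by (subst prod.inter_restrict) auto
  also have "\<dots> = (-1) ^ card ?S" using S by (simp add: Int_absorb1)
  finally have 1: "(\<Prod>a\<in>N. \<Prod>b\<in>N. if a \<in> A \<and> b \<in> B \<and> b < a then -1 else (1::'f)) = (-1) ^ card ?S" .
  have "(\<Prod>a\<in>N. if a \<in> A \<and> a \<in> B then metric p q a else (1::'f))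
      = (\<Prod>a\<in>N. if a \<in> A \<inter> B then metric p q a else 1)" by simp
  also have "\<dots> = (\<Prod>a\<in>N \<inter> (A \<inter> B). metric p q a)"
    using assms(1) by (subst prod.inter_restrict) auto
  also have "N \<inter> (A \<inter> B) = A \<inter> B" using assms by auto
  finally show ?thesis using 1 by (simp add: blade_coeff_def)
qed

lemma blade_coeff_cocycle:
  assumes "finite N" "A \<subseteq> N" "B \<subseteq> N" "C \<subseteq> N"
  shows "blade_coeff p q A B * blade_coeff p q (sym_diff A B) C
       = blade_coeff p q B C * (blade_coeff p q A (sym_diff B C) :: 'f::field)"
proof -
  have AB: "sym_diff A B \<subseteq> N" and BC: "sym_diff B C \<subseteq> N" using assms by auto
  let ?g = "\<lambda>A B. \<Prod>a\<in>N. \<Prod>b\<in>N. if a \<in> A \<and> b \<in> B \<and> b < a then -1 else (1::'f)"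
  let ?m = "\<lambda>A B. \<Prod>a\<in>N. if a \<in> A \<and> a \<in> B then metric p q a else (1::'f)"
  have g: "?g A B * ?g (sym_diff A B) C = ?g B C * ?g A (sym_diff B C)"
    unfolding prod.distrib[symmetric] by (intro prod.cong refl) auto
  have m: "?m A B * ?m (sym_diff A B) C = ?m B C * ?m A (sym_diff B C)"
    unfolding prod.distrib[symmetric] by (intro prod.cong refl) auto
  have "(?g A B * ?m A B) * (?g (sym_diff A B) C * ?m (sym_diff A B) C)
      = (?g A B * ?g (sym_diff A B) C) * (?m A B * ?m (sym_diff A B) C)"
    by (simp only: mult_ac)
  also have "\<dots> = (?g B C * ?g A (sym_diff B C)) * (?m B C * ?m A (sym_diff B C))"
    unfolding g m ..
  also have "\<dots> = (?g B C * ?m B C) * (?g A (sym_diff B C) * ?m A (sym_diff B C))"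
    by (simp only: mult_ac)
  finally show ?thesis
    unfolding blade_coeff_prod[OF assms(1,2,3)] blade_coeff_prod[OF assms(1) AB assms(4)]
      blade_coeff_prod[OF assms(1,3,4)] blade_coeff_prod[OF assms(1,2) BC] .
qed

lemma blade_coeff_empty [simp]:
  "blade_coeff p q {} B = 1" "blade_coeff p q A {} = 1"
  by (simp_all add: blade_coeff_def)

lemma Cl_mult_closed:
  assumes "U \<in> carrier (Cl p q r)" "V \<in> carrier (Cl p q r)"
  shows "U \<otimes>\<^bsub>Cl p q r\<^esub> V \<in> carrier (Cl p q r)"
proof -
  have "(\<Sum>A\<in>Pow {1..p+q+r}. \<Sum>B\<in>Pow {1..p+q+r}.
     if sym_diff A B = C then blade_coeff p q A B * U A * V B else 0) = 0"
    if "\<not> C \<subseteq> {1..p+q+r}" for C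
    using that by (intro sum.neutral ballI) auto
  then show ?thesis unfolding Cl_simps by blast
qed

lemma Cl_assoc:
  fixes U V W :: "'f::field mv"
  shows "(U \<otimes>\<^bsub>Cl p q r\<^esub> V) \<otimes>\<^bsub>Cl p q r\<^esub> W = U \<otimes>\<^bsub>Cl p q r\<^esub> (V \<otimes>\<^bsub>Cl p q r\<^esub> W)"
proof
  fix E
  let ?N = "{1..p+q+r}" let ?P = "Pow ?N" and ?w = "blade_coeff p q :: _ \<Rightarrow> _ \<Rightarrow> 'f"
  let ?t = "\<lambda>A B C. if sym_diff (sym_diff A B) C = E
     then ?w A B * ?w (sym_diff A B) C * U A * V B * W C else 0"
  let ?s = "\<lambda>A B C. if sym_diff A (sym_diff B C) = E
     then ?w B C * ?w A (sym_diff B C) * U A * V B * W C else 0"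
  have P: "sym_diff A B \<in> ?P" if "A \<in> ?P" "B \<in> ?P" for A B using that by auto
  have fP: "finite ?P" by simp
  have "((U \<otimes>\<^bsub>Cl p q r\<^esub> V) \<otimes>\<^bsub>Cl p q r\<^esub> W) E
     = (\<Sum>D\<in>?P. \<Sum>C\<in>?P. \<Sum>A\<in>?P. \<Sum>B\<in>?P. if D = sym_diff A B then ?t A B C else 0)"
    unfolding Cl_simps
  proof (intro sum.cong refl)
    fix D C
    show "(if sym_diff D C = E then ?w D C *
        (\<Sum>A\<in>?P. \<Sum>B\<in>?P. if sym_diff A B = D then ?w A B * U A * V B else 0) * W C else 0)
      = (\<Sum>A\<in>?P. \<Sum>B\<in>?P. if D = sym_diff A B then ?t A B C else 0)"
    proof (cases "sym_diff D C = E")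
      case True
      then show ?thesis
        unfolding if_P[OF True] sum_distrib_left sum_distrib_right
        by (intro sum.cong refl) (auto simp only: mult_ac mult_zero_left mult_zero_right split: if_split)
    next
      case False
      then show ?thesis
        unfolding if_not_P[OF False] by (intro sum.neutral[symmetric] ballI sum.neutral) (simp only: if_False split: if_split, blast)
    qed
  qed
  also have "\<dots> = (\<Sum>C\<in>?P. \<Sum>A\<in>?P. \<Sum>B\<in>?P. \<Sum>D\<in>?P. if D = sym_diff A B then ?t A B C else 0)"
    by (rule trans[OF sum.swap], rule sum.cong[OF refl], rule trans[OF sum.swap],
        rule sum.cong[OF refl], rule sum.swap)
  also have "\<dots> = (\<Sum>C\<in>?P. \<Sum>A\<in>?P. \<Sum>B\<in>?P. ?t A B C)"
    by (intro sum.cong refl, subst sum.delta[OF fP]) (simp only: P if_True)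
  also have "\<dots> = (\<Sum>A\<in>?P. \<Sum>B\<in>?P. \<Sum>C\<in>?P. ?t A B C)"
    by (rule trans[OF sum.swap], rule sum.cong[OF refl], rule sum.swap)
  also have "\<dots> = (\<Sum>A\<in>?P. \<Sum>B\<in>?P. \<Sum>C\<in>?P. ?s A B C)"
  proof (intro sum.cong refl)
    fix A B C assume "A \<in> ?P" "B \<in> ?P" "C \<in> ?P"
    then have "?w A B * ?w (sym_diff A B) C = ?w B C * ?w A (sym_diff B C)"
      by (intro blade_coeff_cocycle[of ?N]) auto
    moreover have "sym_diff (sym_diff A B) C = sym_diff A (sym_diff B C)" by auto
    ultimately show "?t A B C = ?s A B C" by simp
  qed
  also have "\<dots> = (\<Sum>A\<in>?P. \<Sum>B\<in>?P. \<Sum>C\<in>?P. \<Sum>D\<in>?P. if D = sym_diff B C then ?s A B C else 0)"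
    by (intro sum.cong refl, subst sum.delta[OF fP]) (simp only: P if_True)
  also have "\<dots> = (\<Sum>A\<in>?P. \<Sum>D\<in>?P. \<Sum>B\<in>?P. \<Sum>C\<in>?P. if D = sym_diff B C then ?s A B C else 0)"
    by (rule sum.cong[OF refl], rule sym, rule trans[OF sum.swap], rule sum.cong[OF refl],
        rule sum.swap)
  also have "\<dots> = (U \<otimes>\<^bsub>Cl p q r\<^esub> (V \<otimes>\<^bsub>Cl p q r\<^esub> W)) E"
    unfolding Cl_simps
  proof (intro sum.cong refl)
    fix A D
    show "(\<Sum>B\<in>?P. \<Sum>C\<in>?P. if D = sym_diff B C then ?s A B C else 0)
      = (if sym_diff A D = E then ?w A D * U A *
        (\<Sum>B\<in>?P. \<Sum>C\<in>?P. if sym_diff B C = D then ?w B C * V B * W C else 0) else 0)"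
    proof (cases "sym_diff A D = E")
      case True
      then show ?thesis
        unfolding if_P[OF True] sum_distrib_left sum_distrib_right
        by (intro sum.cong refl) (auto simp only: mult_ac mult_zero_left mult_zero_right split: if_split)
    next
      case False
      then show ?thesis
        unfolding if_not_P[OF False] by (intro sum.neutral ballI) (simp only: if_False split: if_split, blast)
    qed
  qed
  finally show "((U \<otimes>\<^bsub>Cl p q r\<^esub> V) \<otimes>\<^bsub>Cl p q r\<^esub> W) E = (U \<otimes>\<^bsub>Cl p q r\<^esub> (V \<otimes>\<^bsub>Cl p q r\<^esub> W)) E" .
qed

lemma blade_mult_blade:
  assumes "A \<subseteq> {1..p+q+r}" "B \<subseteq> {1..p+q+r}"
  shows "blade A \<otimes>\<^bsub>Cl p q r\<^esub> blade B = blade_coeff p q A B \<odot>\<^bsub>Cl p q r\<^esub> blade (sym_diff A B)"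
proof
  fix C
  let ?P = "Pow {1..p+q+r}"
  have "(blade A \<otimes>\<^bsub>Cl p q r\<^esub> blade B) C
    = (\<Sum>A'\<in>?P. \<Sum>B'\<in>?P. if B' = B then
        (if A' = A then (if sym_diff A B = C then blade_coeff p q A B else 0) else 0) else 0)"
    unfolding Cl_simps by (intro sum.cong refl) (simp add: blade_def)
  also have "\<dots> = (if sym_diff A B = C then blade_coeff p q A B else 0)"
    using assms by simp
  also have "\<dots> = (blade_coeff p q A B \<odot>\<^bsub>Cl p q r\<^esub> blade (sym_diff A B)) C"
    unfolding Cl_simps blade_def by (cases "sym_diff A B = C") simp_all
  finally show "(blade A \<otimes>\<^bsub>Cl p q r\<^esub> blade B) C
      = (blade_coeff p q A B \<odot>\<^bsub>Cl p q r\<^esub> blade (sym_diff A B)) C" .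
qed

lemma Cl_one_left:
  assumes "U \<in> carrier (Cl p q r)"
  shows "\<one>\<^bsub>Cl p q r\<^esub> \<otimes>\<^bsub>Cl p q r\<^esub> U = U"
proof
  fix C
  let ?P = "Pow {1..p+q+r}"
  have "(\<one>\<^bsub>Cl p q r\<^esub> \<otimes>\<^bsub>Cl p q r\<^esub> U) C
    = (\<Sum>A\<in>?P. \<Sum>B\<in>?P. if B = C then (if A = {} then U B else 0) else 0)"
    unfolding Cl_simps by (intro sum.cong refl) (simp add: blade_def)
  also have "\<dots> = (if C \<in> ?P then U C else 0)" by simp
  also have "\<dots> = U C" using assms unfolding Cl_simps by auto
  finally show "(\<one>\<^bsub>Cl p q r\<^esub> \<otimes>\<^bsub>Cl p q r\<^esub> U) C = U C" .
qed

lemma Cl_one_right: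
  assumes "U \<in> carrier (Cl p q r)"
  shows "U \<otimes>\<^bsub>Cl p q r\<^esub> \<one>\<^bsub>Cl p q r\<^esub> = U"
proof
  fix C
  let ?P = "Pow {1..p+q+r}"
  have "(U \<otimes>\<^bsub>Cl p q r\<^esub> \<one>\<^bsub>Cl p q r\<^esub>) C
    = (\<Sum>A\<in>?P. \<Sum>B\<in>?P. if B = {} then (if A = C then U A else 0) else 0)"
    unfolding Cl_simps by (intro sum.cong refl) (simp add: blade_def)
  also have "\<dots> = (if C \<in> ?P then U C else 0)" by simp
  also have "\<dots> = U C" using assms unfolding Cl_simps by auto
  finally show "(U \<otimes>\<^bsub>Cl p q r\<^esub> \<one>\<^bsub>Cl p q r\<^esub>) C = U C" .
qed

lemma ring_Cl: "ring (Cl p q r :: ('f::field, 'f mv) module)"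
proof (rule ringI)
  show "abelian_group (Cl p q r :: ('f, 'f mv) module)"
  proof (rule abelian_groupI)
    fix U :: "'f mv" assume U: "U \<in> carrier (Cl p q r)"
    show "\<exists>V\<in>carrier (Cl p q r). V \<oplus>\<^bsub>Cl p q r\<^esub> U = \<zero>\<^bsub>Cl p q r\<^esub>"
      using U by (intro bexI[of _ "\<lambda>A. - U A"]) (auto simp: Cl_simps)
  next
    fix U V :: "'f mv" assume "U \<in> carrier (Cl p q r)" "V \<in> carrier (Cl p q r)"
    then have "A \<subseteq> {1..p+q+r}" if "U A + V A \<noteq> 0" for A
      using that by (cases "U A = 0") (auto simp: Cl_simps)
    then show "U \<oplus>\<^bsub>Cl p q r\<^esub> V \<in> carrier (Cl p q r)"
      unfolding Cl_simps by blast
  qed (auto simp: Cl_simps add_ac)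
  show "monoid (Cl p q r :: ('f, 'f mv) module)"
    by (rule monoidI)
       (auto simp: Cl_mult_closed Cl_assoc Cl_one_left Cl_one_right, simp add: Cl_simps blade_def)
  fix U V W :: "'f mv"
  have d: "(if b then x + y else (0::'f)) = (if b then x else 0) + (if b then y else 0)" for b x y
    by simp
  show "(U \<oplus>\<^bsub>Cl p q r\<^esub> V) \<otimes>\<^bsub>Cl p q r\<^esub> W
      = U \<otimes>\<^bsub>Cl p q r\<^esub> W \<oplus>\<^bsub>Cl p q r\<^esub> V \<otimes>\<^bsub>Cl p q r\<^esub> W"
    unfolding Cl_simps by (simp only: distrib_left distrib_right d sum.distrib)
  show "W \<otimes>\<^bsub>Cl p q r\<^esub> (U \<oplus>\<^bsub>Cl p q r\<^esub> V)
      = W \<otimes>\<^bsub>Cl p q r\<^esub> U \<oplus>\<^bsub>Cl p q r\<^esub> W \<otimes>\<^bsub>Cl p q r\<^esub> V"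
    unfolding Cl_simps by (simp only: distrib_left distrib_right d sum.distrib)
qed

lemma Cl_generators:
  assumes "a \<in> {1..p+q+r}" "b \<in> {1..p+q+r}"
  shows "(blade {a} \<otimes>\<^bsub>Cl p q r\<^esub> blade {b}) \<oplus>\<^bsub>Cl p q r\<^esub> (blade {b} \<otimes>\<^bsub>Cl p q r\<^esub> blade {a})
       = (2 * (if a = b then metric p q a else 0)) \<odot>\<^bsub>Cl p q r\<^esub> \<one>\<^bsub>Cl p q r\<^esub>"
proof -
  have s: "{(x, y). x = c \<and> y = d \<and> y < x} = (if d < c then {(c, d)} else {})" for c d :: nat
    by auto
  have "{a} \<subseteq> {1..p+q+r}" "{b} \<subseteq> {1..p+q+r}" using assms by auto
  then show ?thesis
    by (cases a b rule: linorder_cases)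
       (auto simp: blade_mult_blade, auto simp: Cl_simps blade_coeff_def s blade_def insert_commute)
qed

lemma blade_insert:
  assumes "insert a A \<subseteq> {1..p+q+r}" "\<forall>b\<in>A. a < b"
  shows "blade {a} \<otimes>\<^bsub>Cl p q r\<^esub> blade A = (blade (insert a A) :: 'f::field mv)"
proof -
  have e: "{(x, y). x \<in> {a} \<and> y \<in> A \<and> y < x} = {}" and "a \<notin> A" using assms(2) by fastforce+
  then have "blade_coeff p q {a} A = (1::'f)" and s: "sym_diff {a} A = insert a A"
    unfolding blade_coeff_def e by auto
  moreover have "blade {a} \<otimes>\<^bsub>Cl p q r\<^esub> (blade A :: 'f mv)
      = blade_coeff p q {a} A \<odot>\<^bsub>Cl p q r\<^esub> blade (sym_diff {a} A)"
    using assms(1) by (intro blade_mult_blade) auto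
  ultimately show ?thesis unfolding s by (simp add: Cl_simps(6))
qed

lemma blade_eq_ordered_product:
  assumes "A \<subseteq> {1..p+q+r}"
  shows "blade A = foldr (\<lambda>a U. blade {a} \<otimes>\<^bsub>Cl p q r\<^esub> U) (sorted_list_of_set A) \<one>\<^bsub>Cl p q r\<^esub>"
proof -
  have "foldr (\<lambda>a U. blade {a} \<otimes>\<^bsub>Cl p q r\<^esub> U) xs \<one>\<^bsub>Cl p q r\<^esub> = blade (set xs)"
    if "sorted_wrt (<) xs" "set xs \<subseteq> {1..p+q+r}" for xs
    using that by (induction xs) (auto simp: Cl_simps(3) intro!: blade_insert)
  from this[of "sorted_list_of_set A"] show ?thesis
    using assms finite_subset[OF assms] by (metis finite_atLeastAtMost
      set_sorted_list_of_set strict_sorted_list_of_set)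
qed

end

theory Submission
  imports Defs
begin

text \<open>
  Two observations reduce the theorem to a combinatorial fact about finite sets.

  First, the condition defining $\tilde\Gamma^{\overline{kl}}$ is an eigenvalue condition.  Each of
  the four pairs consists of one even and one odd residue, and $C\ell^{\overline{kl}}$ is an
  eigenspace, for an eigenvalue $\varepsilon = \pm 1$, of an anti-automorphism $S$: the reversion for
  01 and 23, the Clifford conjugation for 12 and 03.  For $V$ in one of the two summands, $S V =
  \varepsilon V$, so $S(T V T^{-1}) = \varepsilon\, S(T)^{-1} V S(T)$, and this equals
  $\varepsilon\, T V T^{-1}$ exactly if $S(T) T$ commutes with $V$.  In the same way, $\hat T V T^{-1}$
  stays in the eigenspace exactly if $Y = S(\hat T) T$ satisfies $\hat Y V = V Y$.  Of the two
  elements $S(T) T$ and $S(\hat T) T$, one is $\tilde T T$ and the other is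
  $\hat{\tilde T} T$ (lemma \<open>twisted_Gamma_eq_supercentralizers\<close>).

  It remains to replace the whole subspace $C\ell^{\overline k}$ by the single grade $m \in
  \{1,2,3,4\}$ with $m \equiv k$ modulo 4.  Here the centralizers of even grades and the twisted
  centralizers of odd grades are the same kind of object: both ask that $X' V = V X$ for all $V$ of
  grade $m$, where $X'$ is $X$ with the grade involution applied $m$ times.  In coordinates this
  forbids a nonzero coefficient of $X$ at $A$ whenever some $B$ with $|B| = m$
  obstructs $A$, that is, $|A \cap B|$ is odd and $A \cap B$ contains no degenerate index.
  An obstructing $B$ with at least three elements can be shrunk by two elements while remaining
  obstructing (lemma \<open>obstructs_drop_two\<close>).  Hence an obstruction in grade $m + 4i$ yields one in
  grade $m \ge 1$, and grade 0 never obstructs, which gives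
  \<open>supercentralizer_grade_eq_type\<close> and with it the four equalities.
  The same shrinking shows that the grade 1 condition implies the grade 3 condition and the grade 2
  condition implies the grade 4 condition, which is the inclusion of
  $\tilde Q^{\overline{12}}$ in $\tilde Q^{\overline{03}}$.
\<close>

section \<open>Obstructing pairs of index sets\<close>

text \<open>
  With $d = p + q$, the indices up to $d$ are the nondegenerate ones, whose generators have square
  $\pm 1$.  The pairs singled out here are those for which $e_B e_A = (-1)^{|A| |B|} e_A e_B$ fails
  (lemma \<open>blade_coeff_supercommute_iff\<close>).
\<close>

definition obstructs :: "nat \<Rightarrow> nat set \<Rightarrow> nat set \<Rightarrow> bool" where
  "obstructs d A B \<longleftrightarrow> odd (card (A \<inter> B)) \<and> (\<forall>a\<in>A \<inter> B. a \<le> d)"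

text \<open>
  The two removed elements are taken both from $A \cap B$ or both from $B - A$, which keeps the
  parity of the intersection.  One of the two parts has at least two elements: if
  $|A \cap B| = 1$, the other part has $|B| - 1 \ge 2$.
\<close>

lemma obstructs_drop_two:
  assumes "obstructs d A B" "finite B" "3 \<le> card B"
  obtains B' where "B' \<subseteq> B" "obstructs d A B'" "card B' = card B - 2"
proof -
  have split: "card (A \<inter> B) + card (B - A) = card B"
    using assms(2) by (metis Int_commute card_Int_Diff)
  have "\<exists>D \<subseteq> B. card D = 2 \<and> (D \<subseteq> A \<inter> B \<or> D \<inter> A = {})"
  proof (cases "2 \<le> card (A \<inter> B)")
    case True
    then show ?thesis by (meson obtain_subset_with_card_n le_infE)
  next
    case False
    then have "2 \<le> card (B - A)" using split assms(3) by linarith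
    then obtain D where "D \<subseteq> B - A" "card D = 2" by (meson obtain_subset_with_card_n)
    then show ?thesis by blast
  qed
  then obtain D where D: "D \<subseteq> B" "card D = 2" "D \<subseteq> A \<inter> B \<or> D \<inter> A = {}" by blast
  have fD: "finite D" using D(1) assms(2) finite_subset by blast
  have "odd (card (A \<inter> (B - D)))"
    using D(3)
  proof
    assume s: "D \<subseteq> A \<inter> B"
    have "A \<inter> (B - D) = A \<inter> B - D" by blast
    then have "card (A \<inter> (B - D)) = card (A \<inter> B) - 2"
      using card_Diff_subset[OF fD s] D(2) by simp
    moreover have "2 \<le> card (A \<inter> B)"
      using card_mono[OF _ s] assms(2) D(2) by simp
    ultimately show ?thesis using assms(1) by (simp add: obstructs_def)
  next
    assume "D \<inter> A = {}"
    then have "A \<inter> (B - D) = A \<inter> B" by blast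
    then show ?thesis using assms(1) by (simp add: obstructs_def)
  qed
  moreover have "\<forall>a\<in>A \<inter> (B - D). a \<le> d" using assms(1) by (simp add: obstructs_def)
  ultimately have "obstructs d A (B - D)" by (simp add: obstructs_def)
  moreover have "card (B - D) = card B - 2"
    using card_Diff_subset[OF fD D(1)] D(2) by simp
  ultimately show thesis using that[of "B - D"] by blast
qed

lemma obstructs_descend:
  assumes "obstructs d A B" "finite B" "card B = m + 2 * i" "1 \<le> m"
  shows "\<exists>B' \<subseteq> B. obstructs d A B' \<and> card B' = m"
  using assms
proof (induction i arbitrary: B)
  case 0
  then show ?case by auto
next
  case (Suc i)
  then have "3 \<le> card B" by simp
  then obtain B' where B': "B' \<subseteq> B" "obstructs d A B'" "card B' = card B - 2"
    using obstructs_drop_two Suc.prems by blast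
  then have "\<exists>C \<subseteq> B'. obstructs d A C \<and> card C = m"
    using Suc.IH[of B'] Suc.prems finite_subset[OF B'(1)] by simp
  then show ?case using B'(1) by blast
qed

section \<open>Supercommutation in coordinates\<close>

lemma blade_coeff_eq_0_iff:
  assumes "finite A"
  shows "blade_coeff p q A B = (0::'f::field_char_0) \<longleftrightarrow> \<not> (\<forall>a\<in>A \<inter> B. a \<le> p + q)"
  using assms by (auto simp: blade_coeff_def metric_def)

text \<open>
  The pairs in $A \times B$ are the inversions of $(A, B)$, those of $(B, A)$, and the diagonal pairs.
\<close>

lemma blade_coeff_swap:
  assumes "finite A" "finite B"
  shows "blade_coeff p q B A
    = (-1) ^ (card A * card B + card (A \<inter> B)) * (blade_coeff p q A B :: 'f::field)"
proof -
  let ?I = "\<lambda>A B. {(a, b). a \<in> A \<and> b \<in> B \<and> b < (a::nat)}"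
  let ?J = "{(a, b). a \<in> A \<and> b \<in> B \<and> a < b}" and ?D = "(\<lambda>a. (a, a)) ` (A \<inter> B)"
  have fin: "finite (A \<times> B)" using assms by simp
  have fI: "finite (?I A B)" and fJ: "finite ?J" and fD: "finite ?D"
    by (rule finite_subset[OF _ fin]; auto)+
  have J: "card (?I B A) = card ?J"
    by (rule bij_betw_same_card[of prod.swap], rule bij_betwI[of _ _ _ prod.swap]) auto
  have D: "card ?D = card (A \<inter> B)" by (rule card_image) (simp add: inj_on_def)
  have "A \<times> B = (?I A B \<union> ?J) \<union> ?D" by auto
  then have "card A * card B = card ((?I A B \<union> ?J) \<union> ?D)"
    by (metis card_cartesian_product)
  also have "\<dots> = card (?I A B \<union> ?J) + card ?D"
    by (rule card_Un_disjoint) (use fI fJ fD in auto)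
  also have "card (?I A B \<union> ?J) = card (?I A B) + card ?J"
    by (rule card_Un_disjoint) (use fI fJ in auto)
  finally have e: "card A * card B = card (?I A B) + card (?I B A) + card (A \<inter> B)"
    using J D by simp
  have "(-1::'f) ^ card (?I B A) = (-1) ^ (card A * card B + card (A \<inter> B)) * (-1) ^ card (?I A B)"
    unfolding e by (simp add: minus_one_power_iff)
  then show ?thesis by (simp add: blade_coeff_def Int_commute)
qed

lemma blade_coeff_supercommute_iff:
  assumes "finite A" "finite B"
  shows "(-1) ^ (card A * card B) * blade_coeff p q A B = (blade_coeff p q B A :: 'f::field_char_0)
    \<longleftrightarrow> \<not> obstructs (p + q) A B"
  unfolding blade_coeff_swap[OF assms] obstructs_def
  using blade_coeff_eq_0_iff[OF assms(1), of p q B, where 'f='f]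
  by (auto simp: minus_one_power_iff)

lemma grade_inv_funpow_apply: "(grade_inv ^^ m) U A = (-1) ^ (card A * m) * U A"
  by (induction m) (simp_all add: grade_inv_def power_add)

lemma grade_inv_funpow: "(grade_inv ^^ m) U = (if even m then U else grade_inv U)"
  by (auto simp: fun_eq_iff grade_inv_funpow_apply grade_inv_def minus_one_power_iff)

text \<open>
  Multiplying by $e_B$ on either side permutes the basis up to scalars (possibly 0), because
  $A \mapsto A \triangle B$ is a bijection.  So in the next lemmas no cancellation can occur
  between different basis vectors, and supercommutation can be tested on each pair separately.
\<close>

lemma supercommute_if_no_obstruction:
  fixes X V :: "'f::field_char_0 mv"
  assumes "\<And>A B. A \<subseteq> {1..p+q+r} \<Longrightarrow> B \<subseteq> {1..p+q+r} \<Longrightarrow> X A \<noteq> 0 \<Longrightarrow> V B \<noteq> 0 \<Longrightarrow>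
      \<not> obstructs (p + q) A B \<and> (even (card B) \<longleftrightarrow> even m)"
  shows "(grade_inv ^^ m) X \<otimes>\<^bsub>Cl p q r\<^esub> V = V \<otimes>\<^bsub>Cl p q r\<^esub> X"
proof
  fix C
  let ?P = "Pow {1..p+q+r}"
  have "((grade_inv ^^ m) X \<otimes>\<^bsub>Cl p q r\<^esub> V) C
    = (\<Sum>A\<in>?P. \<Sum>B\<in>?P. if sym_diff B A = C then blade_coeff p q B A * V B * X A else 0)"
    unfolding Cl_simps
  proof (intro sum.cong refl)
    fix A B assume A: "A \<in> ?P" and B: "B \<in> ?P"
    then have f: "finite A" "finite B" using finite_subset by auto
    have s: "sym_diff A B = sym_diff B A" by blast
    have "blade_coeff p q A B * (grade_inv ^^ m) X A * V B = blade_coeff p q B A * V B * X A"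
    proof (cases "X A \<noteq> 0 \<and> V B \<noteq> 0")
      case True
      then have "\<not> obstructs (p + q) A B" and par: "even (card B) \<longleftrightarrow> even m"
        using assms A B by auto
      then have "(-1) ^ (card A * card B) * blade_coeff p q A B = (blade_coeff p q B A :: 'f)"
        using blade_coeff_supercommute_iff f by blast
      moreover have "(-1) ^ (card A * card B) = (-1::'f) ^ (card A * m)"
        using par by (simp add: minus_one_power_iff)
      ultimately show ?thesis unfolding grade_inv_funpow_apply by (metis mult.commute mult.assoc)
    next
      case False
      then show ?thesis unfolding grade_inv_funpow_apply by auto
    qed
    then show "(if sym_diff A B = C then blade_coeff p q A B * (grade_inv ^^ m) X A * V B else 0)
      = (if sym_diff B A = C then blade_coeff p q B A * V B * X A else 0)"
      unfolding s by simp
  qed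
  also have "\<dots> = (V \<otimes>\<^bsub>Cl p q r\<^esub> X) C"
    unfolding Cl_simps by (rule sum.swap)
  finally show "((grade_inv ^^ m) X \<otimes>\<^bsub>Cl p q r\<^esub> V) C = (V \<otimes>\<^bsub>Cl p q r\<^esub> X) C" .
qed

lemma mult_blade_right:
  fixes U :: "'f::field mv"
  assumes "A \<subseteq> {1..p+q+r}" "B \<subseteq> {1..p+q+r}"
  shows "(U \<otimes>\<^bsub>Cl p q r\<^esub> blade B) (sym_diff A B) = blade_coeff p q A B * U A"
proof -
  let ?P = "Pow {1..p+q+r}"
  have "(U \<otimes>\<^bsub>Cl p q r\<^esub> blade B) (sym_diff A B)
    = (\<Sum>A'\<in>?P. \<Sum>B'\<in>?P. if B' = B then (if A' = A then blade_coeff p q A B * U A else 0) else 0)"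
    unfolding Cl_simps
  proof (intro sum.cong refl)
    fix A' B'
    have "sym_diff A' B = sym_diff A B \<longleftrightarrow> A' = A" by blast
    then show "(if sym_diff A' B' = sym_diff A B then blade_coeff p q A' B' * U A' * blade B B' else 0)
      = (if B' = B then (if A' = A then blade_coeff p q A B * U A else 0) else 0)"
      by (auto simp: blade_def)
  qed
  also have "\<dots> = blade_coeff p q A B * U A" using assms by simp
  finally show ?thesis .
qed

lemma mult_blade_left:
  fixes U :: "'f::field mv"
  assumes "A \<subseteq> {1..p+q+r}" "B \<subseteq> {1..p+q+r}"
  shows "(blade B \<otimes>\<^bsub>Cl p q r\<^esub> U) (sym_diff A B) = blade_coeff p q B A * U A"
proof -
  let ?P = "Pow {1..p+q+r}"
  have "(blade B \<otimes>\<^bsub>Cl p q r\<^esub> U) (sym_diff A B)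
    = (\<Sum>B'\<in>?P. \<Sum>A'\<in>?P. if A' = A then (if B' = B then blade_coeff p q B A * U A else 0) else 0)"
    unfolding Cl_simps
  proof (intro sum.cong refl)
    fix A' B'
    have "sym_diff B A' = sym_diff A B \<longleftrightarrow> A' = A" by blast
    then show "(if sym_diff B' A' = sym_diff A B then blade_coeff p q B' A' * blade B B' * U A' else 0)
      = (if A' = A then (if B' = B then blade_coeff p q B A * U A else 0) else 0)"
      by (auto simp: blade_def)
  qed
  also have "\<dots> = blade_coeff p q B A * U A" using assms by simp
  finally show ?thesis .
qed

lemma no_obstruction_if_supercommute_blade:
  fixes X :: "'f::field_char_0 mv"
  assumes "A \<subseteq> {1..p+q+r}" "B \<subseteq> {1..p+q+r}" "X A \<noteq> 0" "even (card B) \<longleftrightarrow> even m"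
    and com: "(grade_inv ^^ m) X \<otimes>\<^bsub>Cl p q r\<^esub> blade B = blade B \<otimes>\<^bsub>Cl p q r\<^esub> X"
  shows "\<not> obstructs (p + q) A B"
proof -
  have f: "finite A" "finite B" using assms finite_subset by auto
  have "blade_coeff p q A B * (grade_inv ^^ m) X A = blade_coeff p q B A * X A"
    using mult_blade_right[OF assms(1,2), of "(grade_inv ^^ m) X"]
      mult_blade_left[OF assms(1,2), of X] com by simp
  then have "(-1) ^ (card A * m) * blade_coeff p q A B = (blade_coeff p q B A :: 'f)"
    unfolding grade_inv_funpow_apply using assms(3) by (simp add: mult.left_commute mult.commute)
  moreover have "(-1) ^ (card A * card B) = (-1::'f) ^ (card A * m)"
    using assms(4) by (simp add: minus_one_power_iff)
  ultimately show ?thesis using blade_coeff_supercommute_iff[OF f] by metis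
qed

text \<open>
  The $m$-fold grade involution multiplies the coefficient at $A$ by $(-1)^{|A| m}$, the sign in a
  graded commutator with an element of degree $m$.  Centralizers of even grades and twisted
  centralizers of odd grades thereby become instances of one notion.
\<close>

definition supercentralizer :: "nat \<Rightarrow> nat \<Rightarrow> nat \<Rightarrow> nat \<Rightarrow> 'f::field mv set \<Rightarrow> 'f mv set" where
  "supercentralizer p q r m H = {X \<in> carrier (Cl p q r). \<forall>V \<in> H.
     (grade_inv ^^ m) X \<otimes>\<^bsub>Cl p q r\<^esub> V = V \<otimes>\<^bsub>Cl p q r\<^esub> X}"

lemma centralizer_eq: "even m \<Longrightarrow> centralizer p q r m = supercentralizer p q r m (Cl_grade p q r m)"
  and twisted_centralizer_eq:
    "odd m \<Longrightarrow> twisted_centralizer p q r m = supercentralizer p q r m (Cl_grade p q r m)"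
  by (simp_all add: centralizer_def twisted_centralizer_def supercentralizer_def grade_inv_funpow)

lemma supercentralizer_iff_no_obstruction:
  fixes X :: "'f::field_char_0 mv"
  assumes par: "\<And>B. P B \<Longrightarrow> even (card B) \<longleftrightarrow> even m"
  shows "X \<in> supercentralizer p q r m {V \<in> carrier (Cl p q r). \<forall>B. V B \<noteq> 0 \<longrightarrow> P B} \<longleftrightarrow>
    X \<in> carrier (Cl p q r) \<and>
    (\<forall>A B. X A \<noteq> 0 \<longrightarrow> B \<subseteq> {1..p+q+r} \<longrightarrow> P B \<longrightarrow> \<not> obstructs (p + q) A B)"
    (is "?L \<longleftrightarrow> ?R")
proof
  assume L: ?L
  show ?R
  proof (intro conjI allI impI)
    show X: "X \<in> carrier (Cl p q r)" using L by (simp add: supercentralizer_def)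
    fix A B assume AB: "X A \<noteq> 0" "B \<subseteq> {1..p+q+r}" "P B"
    have "A \<subseteq> {1..p+q+r}" using X AB(1) by (simp add: Cl_simps)
    moreover have "blade B \<in> {V \<in> carrier (Cl p q r). \<forall>B. V B \<noteq> (0::'f) \<longrightarrow> P B}"
      using AB by (auto simp: Cl_simps blade_def split: if_splits)
    then have "(grade_inv ^^ m) X \<otimes>\<^bsub>Cl p q r\<^esub> blade B = blade B \<otimes>\<^bsub>Cl p q r\<^esub> X"
      using L unfolding supercentralizer_def by blast
    ultimately show "\<not> obstructs (p + q) A B"
      using no_obstruction_if_supercommute_blade AB par by blast
  qed
next
  assume R: ?R
  then show ?L
    unfolding supercentralizer_def
    by (auto intro!: supercommute_if_no_obstruction simp: par)
qed

lemma supercentralizer_grade_iff_no_obstruction: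
  fixes X :: "'f::field_char_0 mv"
  shows "X \<in> supercentralizer p q r m (Cl_grade p q r m) \<longleftrightarrow> X \<in> carrier (Cl p q r) \<and>
    (\<forall>A B. X A \<noteq> 0 \<longrightarrow> B \<subseteq> {1..p+q+r} \<longrightarrow> card B = m \<longrightarrow> \<not> obstructs (p + q) A B)"
  unfolding Cl_grade_def by (rule supercentralizer_iff_no_obstruction) simp

section \<open>Subspaces determined by the grade modulo four\<close>

lemma even_triangular_iff: "even (c * (c - 1) div 2) \<longleftrightarrow> c mod 4 < 2" for c :: nat
proof -
  define d where "d = c div 4"
  have c: "c = 4 * d + c mod 4" by (simp add: d_def)
  have "c mod 4 < 4" by simp
  then consider "c = 4 * d" "c mod 4 = 0" | "c = 4 * d + 1" "c mod 4 = 1"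
    | "c = 4 * d + 2" "c mod 4 = 2" | "c = 4 * d + 3" "c mod 4 = 3"
    using c by linarith
  then show ?thesis
  proof cases
    case 1
    then have "c * (c - 1) = 2 * (2 * (d * (c - 1)))" by simp
    then show ?thesis using 1 by simp
  next
    case 2
    then have "c * (c - 1) = 2 * (2 * (d * c))" by simp
    then show ?thesis using 2 by simp
  next
    case 3
    then have "c * (c - 1) = 2 * ((2 * d + 1) * (4 * d + 1))" by (simp add: algebra_simps)
    then show ?thesis using 3 by simp
  next
    case 4
    then have "c * (c - 1) = 2 * ((4 * d + 3) * (2 * d + 1))" by (simp add: algebra_simps)
    then show ?thesis using 4 by simp
  qed
qed

text \<open>
  The parity of $c$ and that of $c(c-1)/2$ together determine $c$ modulo 4, so the joint eigenspaces
  of the grade involution and the reversion are described by their supports.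
\<close>

lemma Cl_type_eq:
  assumes "k < 4"
  shows "(Cl_type p q r k :: 'f::field_char_0 mv set)
    = {U \<in> carrier (Cl p q r). \<forall>A. U A \<noteq> 0 \<longrightarrow> card A mod 4 = k}"
proof -
  have neg: "(-1) ^ i * u = (-1) ^ j * u \<longleftrightarrow> u = 0 \<or> (even i \<longleftrightarrow> even j)" for u :: 'f and i j :: nat
    by (auto simp: minus_one_power_iff)
  have "card A mod 4 = k \<longleftrightarrow> (even (card A) \<longleftrightarrow> even k) \<and> (card A mod 4 < 2 \<longleftrightarrow> k mod 4 < 2)"
    for A :: "nat set"
  proof -
    have "k = 0 \<or> k = 1 \<or> k = 2 \<or> k = 3" using assms by linarith
    then show ?thesis by (elim disjE; simp only:; presburger)
  qed
  then show ?thesis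
    unfolding Cl_type_def grade_inv_def reversion_def Cl_simps(6) fun_eq_iff neg even_triangular_iff
    by blast
qed

lemma Cl_type2_eq:
  assumes "k < 4" "l < 4"
  shows "(Cl_type2 p q r k l :: 'f::field_char_0 mv set)
    = {U \<in> carrier (Cl p q r). \<forall>A. U A \<noteq> 0 \<longrightarrow> card A mod 4 = k \<or> card A mod 4 = l}"
    (is "_ = ?R")
proof
  show "(Cl_type2 p q r k l :: 'f mv set) \<subseteq> ?R"
  proof
    fix U :: "'f mv" assume "U \<in> Cl_type2 p q r k l"
    then obtain V W where V: "V \<in> Cl_type p q r k" and W: "W \<in> Cl_type p q r l"
      and U: "U = V \<oplus>\<^bsub>Cl p q r\<^esub> W"
      unfolding Cl_type2_def set_add_def' by blast
    have "V A \<noteq> 0 \<or> W A \<noteq> 0" if "U A \<noteq> 0" for A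
      using that unfolding U Cl_simps by auto
    then show "U \<in> ?R"
      using V W unfolding Cl_type_eq[OF assms(1)] Cl_type_eq[OF assms(2)] Cl_simps by blast
  qed
  show "?R \<subseteq> Cl_type2 p q r k l"
  proof
    fix U :: "'f mv" assume U: "U \<in> ?R"
    let ?V = "\<lambda>A. if card A mod 4 = k then U A else 0"
    let ?W = "\<lambda>A. if card A mod 4 = k then 0 else U A"
    have "?V \<in> Cl_type p q r k" "?W \<in> Cl_type p q r l"
      using U unfolding Cl_type_eq[OF assms(1)] Cl_type_eq[OF assms(2)] by (auto simp: Cl_simps)
    moreover have "U = ?V \<oplus>\<^bsub>Cl p q r\<^esub> ?W" by (auto simp: Cl_simps)
    ultimately show "U \<in> Cl_type2 p q r k l"
      unfolding Cl_type2_def set_add_def' by blast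
  qed
qed

text \<open>
  A set obstructing in a grade congruent to $m$ is nonempty, hence, as $m \le 4$, it has at least $m$
  elements and shrinks to an obstructing set of size exactly $m$.  Grade 4 thus stands for
  the residue 0.
\<close>

lemma supercentralizer_grade_eq_type:
  assumes "1 \<le> m" "m \<le> 4"
  shows "supercentralizer p q r m (Cl_grade p q r m :: 'f::field_char_0 mv set)
    = supercentralizer p q r m (Cl_type p q r (m mod 4))"
proof -
  have k: "m mod 4 < 4" by simp
  have par: "card B mod 4 = m mod 4 \<Longrightarrow> even (card B) \<longleftrightarrow> even m" for B :: "nat set"
    by presburger
  have "(\<forall>B. B \<subseteq> {1..p+q+r} \<longrightarrow> card B = m \<longrightarrow> \<not> obstructs (p + q) A B) \<longleftrightarrow>
    (\<forall>B. B \<subseteq> {1..p+q+r} \<longrightarrow> card B mod 4 = m mod 4 \<longrightarrow> \<not> obstructs (p + q) A B)"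
    (is "?L \<longleftrightarrow> ?R") for A
  proof
    assume L: ?L
    show ?R
    proof (intro allI impI notI)
      fix B assume B: "B \<subseteq> {1..p+q+r}" "card B mod 4 = m mod 4" "obstructs (p + q) A B"
      have fB: "finite B" using B(1) finite_subset by auto
      have "B \<noteq> {}" using B(3) by (auto simp: obstructs_def)
      then have "card B \<noteq> 0" using fB by simp
      then have "\<exists>i. card B = m + 2 * i" using B(2) assms by presburger
      then obtain B' where "B' \<subseteq> B" "obstructs (p + q) A B'" "card B' = m"
        using obstructs_descend[OF B(3) fB _ assms(1)] by blast
      then show False using L B(1) by blast
    qed
  next
    assume ?R
    then show ?L by simp
  qed
  then show ?thesis
    unfolding Cl_type_eq[OF k] set_eq_iff supercentralizer_grade_iff_no_obstruction
    using supercentralizer_iff_no_obstruction[of "\<lambda>B. card B mod 4 = m mod 4" m, where 'f='f]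
    by (simp add: par)
qed

lemma supercentralizer_grade_mono:
  assumes "1 \<le> m"
  shows "supercentralizer p q r m (Cl_grade p q r m :: 'f::field_char_0 mv set)
    \<subseteq> supercentralizer p q r (m + 2 * i) (Cl_grade p q r (m + 2 * i))"
proof
  fix X :: "'f mv" assume X: "X \<in> supercentralizer p q r m (Cl_grade p q r m)"
  have "\<not> obstructs (p + q) A B" if h: "X A \<noteq> 0" "B \<subseteq> {1..p+q+r}" "card B = m + 2 * i" for A B
  proof
    assume o: "obstructs (p + q) A B"
    have "finite B" using h(2) finite_subset by auto
    then obtain B' where "B' \<subseteq> B" "obstructs (p + q) A B'" "card B' = m"
      using obstructs_descend[OF o _ h(3) assms] by blast
    then show False
      using X h(1,2) unfolding supercentralizer_grade_iff_no_obstruction by blast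
  qed
  then show "X \<in> supercentralizer p q r (m + 2 * i) (Cl_grade p q r (m + 2 * i))"
    using X unfolding supercentralizer_grade_iff_no_obstruction by blast
qed

section \<open>The involutions as signed rescalings\<close>

text \<open>
  Reversion, Clifford conjugation and the grade involution all act diagonally on the basis.  A
  diagonal map respects or reverses products as soon as its weights satisfy a cocycle-like identity
  on pairs of index sets, so multiplicativity needs to be checked on signs only.
\<close>

definition rescale :: "(nat set \<Rightarrow> 'f) \<Rightarrow> 'f::field mv \<Rightarrow> 'f mv" where
  "rescale s U = (\<lambda>A. s A * U A)"

lemma rescale_closed: "U \<in> carrier (Cl p q r) \<Longrightarrow> rescale s U \<in> carrier (Cl p q r)"
  by (auto simp: Cl_simps rescale_def)

lemma rescale_mult:
  fixes U V :: "'f::field mv"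
  assumes "\<And>A B. finite A \<Longrightarrow> finite B \<Longrightarrow> s (sym_diff A B) = s A * s B"
  shows "rescale s (U \<otimes>\<^bsub>Cl p q r\<^esub> V) = rescale s U \<otimes>\<^bsub>Cl p q r\<^esub> rescale s V"
proof
  fix C
  let ?P = "Pow {1..p+q+r}"
  show "rescale s (U \<otimes>\<^bsub>Cl p q r\<^esub> V) C = (rescale s U \<otimes>\<^bsub>Cl p q r\<^esub> rescale s V) C"
    unfolding Cl_simps rescale_def sum_distrib_left
  proof (intro sum.cong refl)
    fix A B assume "A \<in> ?P" "B \<in> ?P"
    then have "finite A" "finite B" using finite_subset by auto
    then show "s C * (if sym_diff A B = C then blade_coeff p q A B * U A * V B else 0)
      = (if sym_diff A B = C then blade_coeff p q A B * (s A * U A) * (s B * V B) else 0)"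
      using assms[of A B] by auto
  qed
qed

lemma rescale_mult_reverse:
  fixes U V :: "'f::field mv"
  assumes "\<And>A B. finite A \<Longrightarrow> finite B \<Longrightarrow>
      s (sym_diff A B) = (-1) ^ (card A * card B + card (A \<inter> B)) * s A * s B"
  shows "rescale s (U \<otimes>\<^bsub>Cl p q r\<^esub> V) = rescale s V \<otimes>\<^bsub>Cl p q r\<^esub> rescale s U"
proof
  fix C
  let ?P = "Pow {1..p+q+r}"
  have "rescale s (U \<otimes>\<^bsub>Cl p q r\<^esub> V) C
    = (\<Sum>A\<in>?P. \<Sum>B\<in>?P. if sym_diff B A = C
        then blade_coeff p q B A * (s B * V B) * (s A * U A) else 0)"
    unfolding Cl_simps rescale_def sum_distrib_left
  proof (intro sum.cong refl)
    fix A B assume "A \<in> ?P" "B \<in> ?P"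
    then have f: "finite A" "finite B" using finite_subset by auto
    have "s (sym_diff A B) * blade_coeff p q A B = blade_coeff p q B A * s A * s B"
      unfolding assms[OF f] blade_coeff_swap[OF f] by (simp add: mult_ac)
    then have "s (sym_diff A B) * (blade_coeff p q A B * U A * V B)
      = blade_coeff p q B A * (s B * V B) * (s A * U A)"
      by (metis (no_types, lifting) mult.assoc mult.commute)
    moreover have "sym_diff A B = sym_diff B A" by blast
    ultimately show "s C * (if sym_diff A B = C then blade_coeff p q A B * U A * V B else 0)
      = (if sym_diff B A = C then blade_coeff p q B A * (s B * V B) * (s A * U A) else 0)"
      by auto
  qed
  also have "\<dots> = (rescale s V \<otimes>\<^bsub>Cl p q r\<^esub> rescale s U) C"
    unfolding Cl_simps rescale_def by (rule sum.swap)
  finally show "rescale s (U \<otimes>\<^bsub>Cl p q r\<^esub> V) C = (rescale s V \<otimes>\<^bsub>Cl p q r\<^esub> rescale s U) C" .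
qed

lemma card_sym_diff:
  assumes "finite A" "finite B"
  shows "card (sym_diff A B) + 2 * card (A \<inter> B) = card A + card B"
proof -
  have "card (sym_diff A B) = card (A - B) + card (B - A)"
    by (rule card_Un_disjoint) (use assms in auto)
  moreover have "card (A \<inter> B) + card (A - B) = card A" "card (A \<inter> B) + card (B - A) = card B"
    using assms by (metis card_Int_Diff, metis Int_commute card_Int_Diff)
  ultimately show ?thesis by linarith
qed

lemma grade_sign_sym_diff:
  assumes "finite A" "finite B"
  shows "(-1) ^ card (sym_diff A B) = (-1) ^ card A * (-1::'f::field) ^ card B"
proof -
  have "even (card (sym_diff A B)) \<longleftrightarrow> even (card A + card B)"
    using card_sym_diff[OF assms] by presburger
  then show ?thesis by (auto simp: minus_one_power_iff)
qed

lemma grade_inv_mult: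
  "grade_inv (U \<otimes>\<^bsub>Cl p q r\<^esub> V) = grade_inv U \<otimes>\<^bsub>Cl p q r\<^esub> (grade_inv V :: 'f::field mv)"
  using rescale_mult[of "\<lambda>A. (-1) ^ card A" p q r U V, OF grade_sign_sym_diff]
  unfolding rescale_def grade_inv_def by blast

definition rev_sign :: "nat set \<Rightarrow> 'f::field" where
  "rev_sign A = (-1) ^ (card A * (card A - 1) div 2)"

definition conj_sign :: "nat set \<Rightarrow> 'f::field" where
  "conj_sign A = (-1) ^ card A * rev_sign A"

lemma reversion_eq: "reversion = rescale rev_sign"
  by (simp add: fun_eq_iff reversion_def rescale_def rev_sign_def)

lemma cliff_conj_eq: "cliff_conj = rescale conj_sign"
  by (simp add: fun_eq_iff cliff_conj_def grade_inv_def reversion_eq rescale_def conj_sign_def)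

text \<open>
  With $c = a + b - 2t$ one has $\binom c2 = \binom a2 + \binom b2 + ab + t + 2 (t^2 - ta - tb)$.
\<close>

lemma even_triangular_add:
  fixes a b c t :: nat
  assumes "c + 2 * t = a + b"
  shows "even (c * (c - 1) div 2)
    \<longleftrightarrow> even (a * b + t + a * (a - 1) div 2 + b * (b - 1) div 2)"
proof -
  \<comment> \<open>The identity is verified over the integers, where the subtractions do not truncate.\<close>
  have tri: "int (x * (x - 1) div 2) * 2 = int x * int x - int x" for x :: nat
  proof -
    have "even (x * (x - 1))" by (cases x) auto
    then have "x * (x - 1) div 2 * 2 = x * (x - 1)" by simp
    then have "int (x * (x - 1) div 2) * 2 = int (x * (x - 1))" by (metis of_nat_mult of_nat_numeral)
    then show ?thesis by (cases x) (auto simp: algebra_simps)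
  qed
  have c: "int c = int a + int b - 2 * int t" using assms by linarith
  have "2 * int (c * (c - 1) div 2) =
    2 * (int (a * b + t + a * (a - 1) div 2 + b * (b - 1) div 2)
      + 2 * (int t * int t - int t * int a - int t * int b))"
    using tri[of a] tri[of b] tri[of c] unfolding c by (simp add: algebra_simps)
  then have "int (c * (c - 1) div 2) =
    int (a * b + t + a * (a - 1) div 2 + b * (b - 1) div 2)
      + 2 * (int t * int t - int t * int a - int t * int b)"
    by (metis mult_cancel_left zero_neq_numeral)
  then show ?thesis by (metis dvd_add_left_iff dvd_triv_left even_of_nat)
qed

lemma rev_sign_sym_diff:
  assumes "finite A" "finite B"
  shows "rev_sign (sym_diff A B)
    = (-1) ^ (card A * card B + card (A \<inter> B)) * rev_sign A * (rev_sign B :: 'f::field)"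
  using even_triangular_add[OF card_sym_diff[OF assms]]
  by (auto simp: rev_sign_def minus_one_power_iff)

lemma conj_sign_sym_diff:
  assumes "finite A" "finite B"
  shows "conj_sign (sym_diff A B)
    = (-1) ^ (card A * card B + card (A \<inter> B)) * conj_sign A * (conj_sign B :: 'f::field)"
  unfolding conj_sign_def rev_sign_sym_diff[OF assms] grade_sign_sym_diff[OF assms]
  by (simp add: mult_ac)

section \<open>Twisted conjugation\<close>

text \<open>
  This is applied with $s = S(T)$ and $b = S(c)$, where $c$ is $T$ or $\hat T$: the left-hand side then
  compares $S(c V T^{-1})$ with $c V T^{-1}$ up to the common sign.
\<close>

lemma (in monoid) conjugates_eq_iff:
  assumes "s \<in> carrier G" "s' \<in> carrier G" "t \<in> carrier G" "t' \<in> carrier G"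
    and "s \<otimes> s' = \<one>" "s' \<otimes> s = \<one>" "t \<otimes> t' = \<one>" "t' \<otimes> t = \<one>"
    and "v \<in> carrier G" "b \<in> carrier G" "c \<in> carrier G"
  shows "s' \<otimes> (v \<otimes> b) = c \<otimes> v \<otimes> t' \<longleftrightarrow> (s \<otimes> c) \<otimes> v = v \<otimes> (b \<otimes> t)"
proof
  assume e: "s' \<otimes> (v \<otimes> b) = c \<otimes> v \<otimes> t'"
  have "(s \<otimes> c) \<otimes> v = s \<otimes> (c \<otimes> v \<otimes> t') \<otimes> t" using assms by (simp add: m_assoc)
  also have "\<dots> = (s \<otimes> s') \<otimes> v \<otimes> b \<otimes> t" unfolding e[symmetric] using assms(1-4,9-) by (simp add: m_assoc)
  also have "\<dots> = v \<otimes> (b \<otimes> t)" using assms by (simp add: m_assoc)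
  finally show "(s \<otimes> c) \<otimes> v = v \<otimes> (b \<otimes> t)" .
next
  assume e: "(s \<otimes> c) \<otimes> v = v \<otimes> (b \<otimes> t)"
  have "s' \<otimes> (v \<otimes> b) = s' \<otimes> (v \<otimes> (b \<otimes> t)) \<otimes> t'" using assms by (simp add: m_assoc)
  also have "\<dots> = (s' \<otimes> s) \<otimes> c \<otimes> v \<otimes> t'" unfolding e[symmetric] using assms(1-4,9-) by (simp add: m_assoc)
  also have "\<dots> = c \<otimes> v \<otimes> t'" using assms by (simp add: m_assoc)
  finally show "s' \<otimes> (v \<otimes> b) = c \<otimes> v \<otimes> t'" .
qed

lemma monoid_Cl: "monoid (Cl p q r :: ('f::field, 'f mv) module)"
  using ring_Cl by (rule ring.is_monoid)

lemma rescale_Units: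
  fixes T :: "'f::field mv"
  assumes anti: "\<And>U V :: 'f mv. rescale s (U \<otimes>\<^bsub>Cl p q r\<^esub> V) = rescale s V \<otimes>\<^bsub>Cl p q r\<^esub> rescale s U"
    and "s {} = 1" and T: "T \<in> Units (Cl p q r)"
  shows "rescale s T \<otimes>\<^bsub>Cl p q r\<^esub> rescale s (inv\<^bsub>Cl p q r\<^esub> T) = \<one>\<^bsub>Cl p q r\<^esub>"
    and "rescale s (inv\<^bsub>Cl p q r\<^esub> T) \<otimes>\<^bsub>Cl p q r\<^esub> rescale s T = \<one>\<^bsub>Cl p q r\<^esub>"
    and "rescale s T \<in> Units (Cl p q r)"
proof -
  interpret monoid "Cl p q r :: ('f, 'f mv) module" by (rule monoid_Cl)
  have one: "rescale s \<one>\<^bsub>Cl p q r\<^esub> = \<one>\<^bsub>Cl p q r\<^esub>"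
    using assms(2) by (auto simp: rescale_def Cl_simps blade_def)
  show 1: "rescale s T \<otimes>\<^bsub>Cl p q r\<^esub> rescale s (inv\<^bsub>Cl p q r\<^esub> T) = \<one>\<^bsub>Cl p q r\<^esub>"
    and 2: "rescale s (inv\<^bsub>Cl p q r\<^esub> T) \<otimes>\<^bsub>Cl p q r\<^esub> rescale s T = \<one>\<^bsub>Cl p q r\<^esub>"
    using T by (simp_all add: one flip: anti)
  show "rescale s T \<in> Units (Cl p q r)"
    unfolding Units_def using 1 2 T by (auto intro!: rescale_closed bexI[of _ "rescale s (inv\<^bsub>Cl p q r\<^esub> T)"])
qed

lemma scaled_mult:
  fixes U V :: "'f::field mv"
  shows "(\<lambda>A. c * U A) \<otimes>\<^bsub>Cl p q r\<^esub> V = (\<lambda>A. c * (U \<otimes>\<^bsub>Cl p q r\<^esub> V) A)"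
    and "U \<otimes>\<^bsub>Cl p q r\<^esub> (\<lambda>A. c * V A) = (\<lambda>A. c * (U \<otimes>\<^bsub>Cl p q r\<^esub> V) A)"
  unfolding Cl_simps sum_distrib_left by (intro ext sum.cong refl; simp)+

text \<open>
  The even part of an element of $C\ell^{\overline{kl}}$ is its component in $C\ell^{\overline k}$
  and the odd part is its component in $C\ell^{\overline l}$, so the two summands can be tested
  independently.
\<close>

lemma twisted_Gamma_iff:
  fixes T :: "'f::field_char_0 mv"
  assumes kl: "k < 4" "l < 4" "even k" "odd l"
    and T: "T \<in> Units (Cl p q r)"
  shows "T \<in> twisted_Gamma p q r k l \<longleftrightarrow>
    (\<forall>V \<in> Cl_type p q r k. T \<otimes>\<^bsub>Cl p q r\<^esub> V \<otimes>\<^bsub>Cl p q r\<^esub> inv\<^bsub>Cl p q r\<^esub> T \<in> Cl_type2 p q r k l) \<and>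
    (\<forall>V \<in> Cl_type p q r l. grade_inv T \<otimes>\<^bsub>Cl p q r\<^esub> V \<otimes>\<^bsub>Cl p q r\<^esub> inv\<^bsub>Cl p q r\<^esub> T \<in> Cl_type2 p q r k l)"
    (is "_ \<longleftrightarrow> ?E \<and> ?O")
proof -
  have zl: "U \<otimes>\<^bsub>Cl p q r\<^esub> (\<lambda>A. 0) = (\<lambda>A. 0)" and zr: "(\<lambda>A. 0) \<otimes>\<^bsub>Cl p q r\<^esub> U = (\<lambda>A. 0)"
    for U :: "'f mv"
    using scaled_mult(1)[where c = 0] scaled_mult(2)[where c = 0] by simp_all
  have ev: "card A mod 4 = k \<Longrightarrow> even (card A)" and od: "card A mod 4 = l \<Longrightarrow> odd (card A)"
    for A :: "nat set"
    using kl by presburger+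
  have parts_k: "even_part V = V \<and> odd_part V = (\<lambda>A. 0)" if "V \<in> Cl_type p q r k" for V :: "'f mv"
  proof -
    have "V A \<noteq> 0 \<Longrightarrow> even (card A)" for A
      using that ev unfolding Cl_type_eq[OF kl(1)] by blast
    then show ?thesis by (auto simp: even_part_def odd_part_def fun_eq_iff)
  qed
  have parts_l: "even_part V = (\<lambda>A. 0) \<and> odd_part V = V" if "V \<in> Cl_type p q r l" for V :: "'f mv"
  proof -
    have "V A \<noteq> 0 \<Longrightarrow> odd (card A)" for A
      using that od unfolding Cl_type_eq[OF kl(2)] by blast
    then show ?thesis by (auto simp: even_part_def odd_part_def fun_eq_iff)
  qed
  show ?thesis
  proof
    assume "T \<in> twisted_Gamma p q r k l"
    then have stable: "twisted_ad p q r T V \<in> Cl_type2 p q r k l" if "V \<in> Cl_type2 p q r k l" for V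
      using that unfolding twisted_Gamma_def by blast
    have sub: "(Cl_type p q r k :: 'f mv set) \<subseteq> Cl_type2 p q r k l"
      "(Cl_type p q r l :: 'f mv set) \<subseteq> Cl_type2 p q r k l"
      unfolding Cl_type2_eq[OF kl(1,2)] Cl_type_eq[OF kl(1)] Cl_type_eq[OF kl(2)] by auto
    have ad_k: "twisted_ad p q r T V = T \<otimes>\<^bsub>Cl p q r\<^esub> V \<otimes>\<^bsub>Cl p q r\<^esub> inv\<^bsub>Cl p q r\<^esub> T"
      if "V \<in> Cl_type p q r k" for V
      using parts_k[OF that] by (simp add: twisted_ad_def zl zr) (simp add: Cl_simps(5))
    have ad_l: "twisted_ad p q r T V = grade_inv T \<otimes>\<^bsub>Cl p q r\<^esub> V \<otimes>\<^bsub>Cl p q r\<^esub> inv\<^bsub>Cl p q r\<^esub> T"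
      if "V \<in> Cl_type p q r l" for V
      using parts_l[OF that] by (simp add: twisted_ad_def zl zr) (simp add: Cl_simps(5))
    show "?E \<and> ?O"
    proof (intro conjI ballI)
      fix V :: "'f mv" assume V: "V \<in> Cl_type p q r k"
      show "T \<otimes>\<^bsub>Cl p q r\<^esub> V \<otimes>\<^bsub>Cl p q r\<^esub> inv\<^bsub>Cl p q r\<^esub> T \<in> Cl_type2 p q r k l"
        using stable[OF subsetD[OF sub(1) V]] unfolding ad_k[OF V] .
    next
      fix V :: "'f mv" assume V: "V \<in> Cl_type p q r l"
      show "grade_inv T \<otimes>\<^bsub>Cl p q r\<^esub> V \<otimes>\<^bsub>Cl p q r\<^esub> inv\<^bsub>Cl p q r\<^esub> T \<in> Cl_type2 p q r k l"
        using stable[OF subsetD[OF sub(2) V]] unfolding ad_l[OF V] .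
    qed
  next
    assume EO: "?E \<and> ?O"
    have "twisted_ad p q r T U \<in> Cl_type2 p q r k l" if U: "U \<in> Cl_type2 p q r k l" for U
    proof -
      have supp: "U \<in> carrier (Cl p q r)" "\<And>A. U A \<noteq> 0 \<Longrightarrow> card A mod 4 = k \<or> card A mod 4 = l"
        using U unfolding Cl_type2_eq[OF kl(1,2)] by blast+
      have "even_part U \<in> Cl_type p q r k" "odd_part U \<in> Cl_type p q r l"
        using supp ev od unfolding Cl_type_eq[OF kl(1)] Cl_type_eq[OF kl(2)] Cl_simps(1)
          even_part_def odd_part_def mem_Collect_eq by meson+
      then have in2: "T \<otimes>\<^bsub>Cl p q r\<^esub> even_part U \<otimes>\<^bsub>Cl p q r\<^esub> inv\<^bsub>Cl p q r\<^esub> T \<in> Cl_type2 p q r k l"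
        "grade_inv T \<otimes>\<^bsub>Cl p q r\<^esub> odd_part U \<otimes>\<^bsub>Cl p q r\<^esub> inv\<^bsub>Cl p q r\<^esub> T \<in> Cl_type2 p q r k l"
        using EO by blast+
      have add: "W \<oplus>\<^bsub>Cl p q r\<^esub> W' \<in> Cl_type2 p q r k l"
        if "W \<in> Cl_type2 p q r k l" "W' \<in> Cl_type2 p q r k l" for W W' :: "'f mv"
      proof -
        have "W A \<noteq> 0 \<or> W' A \<noteq> 0" if "(W \<oplus>\<^bsub>Cl p q r\<^esub> W') A \<noteq> 0" for A
          using that by (auto simp: Cl_simps)
        then show ?thesis
          using that unfolding Cl_type2_eq[OF kl(1,2)] Cl_simps(1) by blast
      qed
      show ?thesis unfolding twisted_ad_def using in2 by (rule add)
    qed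
    then show "T \<in> twisted_Gamma p q r k l" using T unfolding twisted_Gamma_def by blast
  qed
qed

text \<open>
  The weights $s$ define the anti-automorphism $S$ whose $e$-eigenspace is $C\ell^{\overline{kl}}$.
\<close>

lemma twisted_Gamma_iff_supercommute:
  fixes T :: "'f::field_char_0 mv"
  assumes kl: "k < 4" "l < 4" "even k" "odd l"
    and T: "T \<in> Units (Cl p q r)"
    and anti: "\<And>U V :: 'f mv. rescale s (U \<otimes>\<^bsub>Cl p q r\<^esub> V) = rescale s V \<otimes>\<^bsub>Cl p q r\<^esub> rescale s U"
    and s1: "s {} = 1" and e: "e * e = 1"
    and eigen: "\<And>A. s A = e \<longleftrightarrow> card A mod 4 = k \<or> card A mod 4 = l"
  shows "T \<in> twisted_Gamma p q r k l \<longleftrightarrow>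
    (\<forall>V \<in> Cl_type p q r k. (rescale s T \<otimes>\<^bsub>Cl p q r\<^esub> T) \<otimes>\<^bsub>Cl p q r\<^esub> V
       = V \<otimes>\<^bsub>Cl p q r\<^esub> (rescale s T \<otimes>\<^bsub>Cl p q r\<^esub> T)) \<and>
    (\<forall>V \<in> Cl_type p q r l. (rescale s T \<otimes>\<^bsub>Cl p q r\<^esub> grade_inv T) \<otimes>\<^bsub>Cl p q r\<^esub> V
       = V \<otimes>\<^bsub>Cl p q r\<^esub> (rescale s (grade_inv T) \<otimes>\<^bsub>Cl p q r\<^esub> T))"
proof -
  interpret monoid "Cl p q r :: ('f, 'f mv) module" by (rule monoid_Cl)
  let ?i = "inv\<^bsub>Cl p q r\<^esub> T" and ?S = "rescale s"
  have gc: "grade_inv U \<in> carrier (Cl p q r)" if "U \<in> carrier (Cl p q r)" for U :: "'f mv"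
    using that by (auto simp: Cl_simps grade_inv_def)
  have mem: "U \<in> Cl_type2 p q r k l \<longleftrightarrow> ?S U = (\<lambda>A. e * U A)"
    if "U \<in> carrier (Cl p q r)" for U
    using that eigen unfolding Cl_type2_eq[OF kl(1,2)] rescale_def fun_eq_iff by auto
  have key: "c \<otimes>\<^bsub>Cl p q r\<^esub> V \<otimes>\<^bsub>Cl p q r\<^esub> ?i \<in> Cl_type2 p q r k l \<longleftrightarrow>
      (?S T \<otimes>\<^bsub>Cl p q r\<^esub> c) \<otimes>\<^bsub>Cl p q r\<^esub> V = V \<otimes>\<^bsub>Cl p q r\<^esub> (?S c \<otimes>\<^bsub>Cl p q r\<^esub> T)"
    if c: "c \<in> carrier (Cl p q r)" and V: "V \<in> carrier (Cl p q r)"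
      and SV: "?S V = (\<lambda>A. e * V A)" for c V
  proof -
    have W: "c \<otimes>\<^bsub>Cl p q r\<^esub> V \<otimes>\<^bsub>Cl p q r\<^esub> ?i \<in> carrier (Cl p q r)" using c V T by simp
    have "?S (c \<otimes>\<^bsub>Cl p q r\<^esub> V \<otimes>\<^bsub>Cl p q r\<^esub> ?i)
      = (\<lambda>A. e * (?S ?i \<otimes>\<^bsub>Cl p q r\<^esub> (V \<otimes>\<^bsub>Cl p q r\<^esub> ?S c)) A)"
      unfolding anti SV scaled_mult ..
    moreover have "e \<noteq> 0" using e by auto
    ultimately have "c \<otimes>\<^bsub>Cl p q r\<^esub> V \<otimes>\<^bsub>Cl p q r\<^esub> ?i \<in> Cl_type2 p q r k l \<longleftrightarrow>
      ?S ?i \<otimes>\<^bsub>Cl p q r\<^esub> (V \<otimes>\<^bsub>Cl p q r\<^esub> ?S c) = c \<otimes>\<^bsub>Cl p q r\<^esub> V \<otimes>\<^bsub>Cl p q r\<^esub> ?i"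
      unfolding mem[OF W] by (simp add: fun_eq_iff)
    also have "\<dots> \<longleftrightarrow> (?S T \<otimes>\<^bsub>Cl p q r\<^esub> c) \<otimes>\<^bsub>Cl p q r\<^esub> V = V \<otimes>\<^bsub>Cl p q r\<^esub> (?S c \<otimes>\<^bsub>Cl p q r\<^esub> T)"
      by (rule conjugates_eq_iff)
        (use c V T rescale_Units[OF anti s1 T] in \<open>auto intro: rescale_closed\<close>)
    finally show ?thesis .
  qed
  have TC: "T \<in> carrier (Cl p q r)" by (rule Units_closed[OF T])
  have "?S V = (\<lambda>A. e * V A) \<and> V \<in> carrier (Cl p q r)"
    if "V \<in> Cl_type p q r k \<or> V \<in> Cl_type p q r l" for V
    using that eigen unfolding Cl_type_eq[OF kl(1)] Cl_type_eq[OF kl(2)] rescale_def fun_eq_iff by auto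
  then show ?thesis
    unfolding twisted_Gamma_iff[OF kl T] using key[OF TC] key[OF gc[OF TC]] by blast
qed

text \<open>
  The weights $s'$ belong to the composition of $S$ with the grade involution, which sends $T$ to
  $S(\hat T)$.  As $S$ commutes with the grade involution, the latter sends $S(\hat T) T$ to
  $S(T) \hat T$, which turns the condition on odd elements into twisted centralization.
\<close>

lemma twisted_Gamma_eq_supercentralizers:
  fixes s s' :: "nat set \<Rightarrow> 'f::field_char_0"
  assumes "1 \<le> m" "m \<le> 4" "1 \<le> m'" "m' \<le> 4" "even m" "odd m'"
    and sd: "\<And>A B. finite A \<Longrightarrow> finite B \<Longrightarrow>
      s (sym_diff A B) = (-1) ^ (card A * card B + card (A \<inter> B)) * s A * s B"
    and "s {} = 1" "e * e = 1"
    and "\<And>A. s A = e \<longleftrightarrow> card A mod 4 = m mod 4 \<or> card A mod 4 = m' mod 4"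
    and s': "\<And>A. s' A = (-1) ^ card A * s A"
  shows "twisted_Gamma p q r (m mod 4) (m' mod 4) = {T \<in> Units (Cl p q r).
     rescale s T \<otimes>\<^bsub>Cl p q r\<^esub> T \<in> invertibles p q r (centralizer p q r m) \<and>
     rescale s' T \<otimes>\<^bsub>Cl p q r\<^esub> T \<in> invertibles p q r (twisted_centralizer p q r m')}"
proof -
  interpret monoid "Cl p q r :: ('f, 'f mv) module" by (rule monoid_Cl)
  have anti: "rescale s (U \<otimes>\<^bsub>Cl p q r\<^esub> V) = rescale s V \<otimes>\<^bsub>Cl p q r\<^esub> rescale s U"
    for U V :: "'f mv"
    by (rule rescale_mult_reverse) (rule sd)
  have hat_s: "rescale s (grade_inv U) = rescale s' U" and
    hat_s': "grade_inv (rescale s' U) = rescale s U" for U :: "'f mv"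
    by (auto simp: rescale_def grade_inv_def s' fun_eq_iff simp flip: power_add mult.assoc)
  have anti': "rescale s' (U \<otimes>\<^bsub>Cl p q r\<^esub> V) = rescale s' V \<otimes>\<^bsub>Cl p q r\<^esub> rescale s' U"
    for U V :: "'f mv"
    unfolding hat_s[symmetric] grade_inv_mult by (rule anti)
  have k: "m mod 4 < 4" "m' mod 4 < 4" "even (m mod 4)" "odd (m' mod 4)"
    using assms(5,6) by presburger+
  have "T \<in> twisted_Gamma p q r (m mod 4) (m' mod 4) \<longleftrightarrow>
     rescale s T \<otimes>\<^bsub>Cl p q r\<^esub> T \<in> invertibles p q r (centralizer p q r m) \<and>
     rescale s' T \<otimes>\<^bsub>Cl p q r\<^esub> T \<in> invertibles p q r (twisted_centralizer p q r m')"
    if T: "T \<in> Units (Cl p q r)" for T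
  proof -
    have "rescale s T \<otimes>\<^bsub>Cl p q r\<^esub> T \<in> Units (Cl p q r)"
      "rescale s' T \<otimes>\<^bsub>Cl p q r\<^esub> T \<in> Units (Cl p q r)"
      using rescale_Units(3)[OF anti assms(8) T] rescale_Units(3)[OF anti' _ T] assms(8) T
      by (simp_all add: s')
    moreover from this have "rescale s T \<otimes>\<^bsub>Cl p q r\<^esub> T \<in> carrier (Cl p q r)"
      "rescale s' T \<otimes>\<^bsub>Cl p q r\<^esub> T \<in> carrier (Cl p q r)"
      by (simp_all only: Units_closed)
    ultimately show ?thesis
      unfolding twisted_Gamma_iff_supercommute[OF k T anti assms(8-10)]
        centralizer_eq[OF assms(5)] twisted_centralizer_eq[OF assms(6)] invertibles_def
        supercentralizer_grade_eq_type[OF assms(1,2)] supercentralizer_grade_eq_type[OF assms(3,4)]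
      by (simp add: supercentralizer_def grade_inv_funpow assms(5,6) grade_inv_mult hat_s hat_s')
  qed
  then show ?thesis unfolding twisted_Gamma_def by blast
qed

section \<open>The four groups\<close>

lemma rev_sign_eq_iff:
  "rev_sign A = (1::'f::field_char_0) \<longleftrightarrow> card A mod 4 = 0 \<or> card A mod 4 = 1"
  "rev_sign A = (-1::'f) \<longleftrightarrow> card A mod 4 = 2 \<or> card A mod 4 = 3"
proof -
  have "card A mod 4 < 2 \<longleftrightarrow> card A mod 4 = 0 \<or> card A mod 4 = 1"
    "\<not> card A mod 4 < 2 \<longleftrightarrow> card A mod 4 = 2 \<or> card A mod 4 = 3"
    by presburger+
  then show "rev_sign A = (1::'f) \<longleftrightarrow> card A mod 4 = 0 \<or> card A mod 4 = 1"
    "rev_sign A = (-1::'f) \<longleftrightarrow> card A mod 4 = 2 \<or> card A mod 4 = 3"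
    unfolding rev_sign_def minus_one_power_iff even_triangular_iff by auto
qed

lemma conj_sign_eq_iff:
  "conj_sign A = (1::'f::field_char_0) \<longleftrightarrow> card A mod 4 = 0 \<or> card A mod 4 = 3"
  "conj_sign A = (-1::'f) \<longleftrightarrow> card A mod 4 = 2 \<or> card A mod 4 = 1"
proof -
  have "(even (card A) \<longleftrightarrow> card A mod 4 < 2) \<longleftrightarrow> card A mod 4 = 0 \<or> card A mod 4 = 3"
    "\<not> (even (card A) \<longleftrightarrow> card A mod 4 < 2) \<longleftrightarrow> card A mod 4 = 2 \<or> card A mod 4 = 1"
    by presburger+
  then show "conj_sign A = (1::'f) \<longleftrightarrow> card A mod 4 = 0 \<or> card A mod 4 = 3"
    "conj_sign A = (-1::'f) \<longleftrightarrow> card A mod 4 = 2 \<or> card A mod 4 = 1"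
    unfolding conj_sign_def rev_sign_def minus_one_power_iff even_triangular_iff by auto
qed

lemma sign_empty [simp]: "rev_sign {} = 1" "conj_sign {} = 1"
  by (simp_all add: rev_sign_def conj_sign_def)

lemma rev_sign_conj: "rev_sign A = (-1) ^ card A * (conj_sign A :: 'f::field)"
  by (simp add: conj_sign_def flip: mult.assoc power_add)

lemma Q01_eq_twisted_Gamma: "(Q01 p q r :: 'f::field_char_0 mv set) = twisted_Gamma p q r 0 1"
  unfolding Q01_def reversion_eq cliff_conj_eq
  using twisted_Gamma_eq_supercentralizers[of 4 1 rev_sign "1::'f" conj_sign p q r]
  by (simp add: rev_sign_sym_diff rev_sign_eq_iff conj_sign_def)

lemma Q23_eq_twisted_Gamma: "(Q23 p q r :: 'f::field_char_0 mv set) = twisted_Gamma p q r 2 3"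
  unfolding Q23_def reversion_eq cliff_conj_eq
  using twisted_Gamma_eq_supercentralizers[of 2 3 rev_sign "-1::'f" conj_sign p q r]
  by (simp add: rev_sign_sym_diff rev_sign_eq_iff conj_sign_def)

text \<open>
  In the pair 12 the even residue comes second, whereas
  \<open>twisted_Gamma_eq_supercentralizers\<close> puts it first.
\<close>

lemma twisted_Gamma_commute:
  "(twisted_Gamma p q r k l :: 'f::field mv set) = twisted_Gamma p q r l k"
proof -
  have "(Cl_type2 p q r k l :: 'f mv set) \<subseteq> Cl_type2 p q r l k" for k l
    unfolding Cl_type2_def set_add_def' Cl_simps(5)
    by clarify (rule UN_I, assumption, rule UN_I, assumption, simp add: fun_eq_iff add.commute)
  then have "(Cl_type2 p q r k l :: 'f mv set) = Cl_type2 p q r l k" by blast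
  then show ?thesis by (simp add: twisted_Gamma_def)
qed

lemma Q12_eq_twisted_Gamma: "(Q12 p q r :: 'f::field_char_0 mv set) = twisted_Gamma p q r 1 2"
  unfolding Q12_def reversion_eq cliff_conj_eq twisted_Gamma_commute[of p q r 1 2]
  using twisted_Gamma_eq_supercentralizers[of 2 1 conj_sign "-1::'f" rev_sign p q r]
  by (simp add: conj_sign_sym_diff conj_sign_eq_iff rev_sign_conj disj_commute conj_commute)

lemma Q03_eq_twisted_Gamma: "(Q03 p q r :: 'f::field_char_0 mv set) = twisted_Gamma p q r 0 3"
  unfolding Q03_def reversion_eq cliff_conj_eq
  using twisted_Gamma_eq_supercentralizers[of 4 3 conj_sign "1::'f" rev_sign p q r]
  by (simp add: conj_sign_sym_diff conj_sign_eq_iff rev_sign_conj disj_commute conj_commute)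

lemma Q12_subset_Q03: "(Q12 p q r :: 'f::field_char_0 mv set) \<subseteq> Q03 p q r"
proof -
  have "(centralizer p q r 2 :: 'f mv set) \<subseteq> centralizer p q r 4"
    using supercentralizer_grade_mono[of 2 p q r 1] by (simp add: centralizer_eq)
  moreover have "(twisted_centralizer p q r 1 :: 'f mv set) \<subseteq> twisted_centralizer p q r 3"
    using supercentralizer_grade_mono[of 1 p q r 1]
    by (simp add: twisted_centralizer_eq numeral_3_eq_3)
  ultimately show ?thesis unfolding Q12_def Q03_def invertibles_def by blast
qed

theorem theorem4p4:
  fixes p q r n :: nat
  assumes "p + q + r = n" and "n \<ge> 1"
  shows
    "((Q01 p q r :: real mv set) = twisted_Gamma p q r 0 1 \<and>
      (Q23 p q r :: real mv set) = twisted_Gamma p q r 2 3 \<and>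
      (Q12 p q r :: real mv set) = twisted_Gamma p q r 1 2 \<and>
      (twisted_Gamma p q r 1 2 :: real mv set) \<subseteq> Q03 p q r \<and>
      (Q03 p q r :: real mv set) = twisted_Gamma p q r 0 3) \<and>
     ((Q01 (p + q) 0 r :: complex mv set) = twisted_Gamma (p + q) 0 r 0 1 \<and>
      (Q23 (p + q) 0 r :: complex mv set) = twisted_Gamma (p + q) 0 r 2 3 \<and>
      (Q12 (p + q) 0 r :: complex mv set) = twisted_Gamma (p + q) 0 r 1 2 \<and>
      (twisted_Gamma (p + q) 0 r 1 2 :: complex mv set) \<subseteq> Q03 (p + q) 0 r \<and>
      (Q03 (p + q) 0 r :: complex mv set) = twisted_Gamma (p + q) 0 r 0 3)"
  using Q12_subset_Q03[of p q r, where 'f=real] Q12_subset_Q03[of "p + q" 0 r, where 'f=complex]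
  by (simp add: Q01_eq_twisted_Gamma Q23_eq_twisted_Gamma Q12_eq_twisted_Gamma Q03_eq_twisted_Gamma)

end
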